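(* For any $0\le\delta\le1$ and $n>\max\left\{2\ln\frac2\delta,\,6\right\}$, a mechanism which uniformly samples and outputs one sample element is $\left(11\sqrt{\frac{\ln(2n/\delta)}{n}},\ \delta\right)$-LSS but is not $\left(1,\frac1{2n}\right)$-LMI.
   Context: $\mathcal X$ is a countable set, samples are $s=(s_1,\dots,s_n)\in\mathcal X^n$ drawn from a distribution $D_{\mathcal X^n}$, and a mechanism $M$ is a possibly randomized function of a sample and a query $q$ with values in a countable response set $\mathcal R$. The mechanism in the claim, for every query, picks one of the $n$ elements of its sample uniformly at random and outputs it (so $\mathcal R=\mathcal X$). For fixed $q$ write $D(r\mid s)=\Pr[M(s,q)=r]$. Induced distributions: $D(s)=D_{\mathcal X^n}(s)$, $D(r)=\sum_sD(s)D(r\mid s)$, $D(s\mid r)=D(s)D(r\mid s)/D(r)$, $D(x\mid s)=\frac1n|\{i:s_i=x\}|$, $D(x)=\sum_sD(s)D(x\mid s)$, $D(x\mid r)=\sum_sD(s\mid r)D(x\mid s)$. On $\mathcal X\times\mathcal R$: joint $D_{(\mathcal X,\mathcal R)}(x,r)=\sum_sD(s)D(x\mid s)D(r\mid s)$ and product $D_{\mathcal X\otimes\mathcal R}(x,r)=D(x)D(r)$. LSS (Local Statistical Stability): with stability loss $\ell(r)=\sum_{x:\,D(x\mid r)>D(x)}(D(x\mid r)-D(x))$, $M$ is $(\epsilon,\delta)$-LSS with respect to $D_{\mathcal X^n},q$ if for every $\mathbf r\subseteq\mathcal R$, $\sum_{r\in\mathbf r}D(r)(\ell(r)-\epsilon)\le\delta$.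 LMI (Local Max Information): $M$ is $(\epsilon,\delta)$-LMI with respect to $D_{\mathcal X^n},q$ if for every $\mathbf b\subseteq\mathcal X\times\mathcal R$, $D_{(\mathcal X,\mathcal R)}(\mathbf b)\le e^\epsilon D_{\mathcal X\otimes\mathcal R}(\mathbf b)+\delta$ and $D_{\mathcal X\otimes\mathcal R}(\mathbf b)\le e^\epsilon D_{(\mathcal X,\mathcal R)}(\mathbf b)+\delta$. The theorem is a separation result (LMI is strictly stronger than LSS) and its statement does not name the domain or the underlying distribution. For orientation only: the source establishes it for $\mathcal X=\{1,\dots,N\}$ with $N>n^2$ and $D_{\mathcal X^n}$ the product of an arbitrary distribution $D_{\mathcal X}$ with $D_{\mathcal X}(x)\le\frac1{n^2}$ for all $x$. *)

theory Defs
  imports "HOL-Probability.Probability"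
begin

text \<open>
  A sample \<open>s = (s\<^sub>1, \<dots>, s\<^sub>n)\<close> is a list of length \<open>n\<close>; a distribution on \<open>X\<^sup>n\<close> is a
  PMF on lists supported on the lists of length \<open>n\<close> over \<open>X\<close>.  Infinite sums over all lists
  are therefore sums over \<open>X\<^sup>n\<close>.  The domain \<open>X\<close> and the response set \<open>R\<close> are carrier sets.

  In the names below, \<open>x\<close> is a sample element, \<open>s\<close> a sample, \<open>r\<close> a response, and
  \<open>D_x_given_r P M q x r\<close> is \<open>D(x | r)\<close> for \<open>P = D\<close> on \<open>X\<^sup>n\<close>, the mechanism \<open>M\<close>, the query \<open>q\<close>.
\<close>

type_synonym ('x, 'q, 'r) mechanism = "'x list \<Rightarrow> 'q \<Rightarrow> 'r pmf"

definition D_r :: "'x list pmf \<Rightarrow> ('x, 'q, 'r) mechanism \<Rightarrow> 'q \<Rightarrow> 'r \<Rightarrow> real" where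
  "D_r P M q r = (\<Sum>\<^sub>\<infinity>s. pmf P s * pmf (M s q) r)"

text \<open>For \<open>D(r) = 0\<close> the following is \<open>0\<close>; such \<open>r\<close> have weight \<open>0\<close> in local statistical stability.\<close>

definition D_s_given_r :: "'x list pmf \<Rightarrow> ('x, 'q, 'r) mechanism \<Rightarrow> 'q \<Rightarrow> 'x list \<Rightarrow> 'r \<Rightarrow> real" where
  "D_s_given_r P M q s r = pmf P s * pmf (M s q) r / D_r P M q r"

definition D_x_given_s :: "'x \<Rightarrow> 'x list \<Rightarrow> real" where
  "D_x_given_s x s = real (card {i. i < length s \<and> s ! i = x}) / real (length s)"

definition D_x :: "'x list pmf \<Rightarrow> 'x \<Rightarrow> real" where
  "D_x P x = (\<Sum>\<^sub>\<infinity>s. pmf P s * D_x_given_s x s)"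

definition D_x_given_r :: "'x list pmf \<Rightarrow> ('x, 'q, 'r) mechanism \<Rightarrow> 'q \<Rightarrow> 'x \<Rightarrow> 'r \<Rightarrow> real" where
  "D_x_given_r P M q x r = (\<Sum>\<^sub>\<infinity>s. D_s_given_r P M q s r * D_x_given_s x s)"

definition D_joint :: "'x list pmf \<Rightarrow> ('x, 'q, 'r) mechanism \<Rightarrow> 'q \<Rightarrow> ('x \<times> 'r) set \<Rightarrow> real" where
  "D_joint P M q b = (\<Sum>\<^sub>\<infinity>(x, r)\<in>b. \<Sum>\<^sub>\<infinity>s. pmf P s * D_x_given_s x s * pmf (M s q) r)"

definition D_product :: "'x list pmf \<Rightarrow> ('x, 'q, 'r) mechanism \<Rightarrow> 'q \<Rightarrow> ('x \<times> 'r) set \<Rightarrow> real" where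
  "D_product P M q b = (\<Sum>\<^sub>\<infinity>(x, r)\<in>b. D_x P x * D_r P M q r)"

definition stability_loss ::
    "'x set \<Rightarrow> 'x list pmf \<Rightarrow> ('x, 'q, 'r) mechanism \<Rightarrow> 'q \<Rightarrow> 'r \<Rightarrow> real" where
  "stability_loss X P M q r =
     (\<Sum>\<^sub>\<infinity>x\<in>{x \<in> X. D_x_given_r P M q x r > D_x P x}. D_x_given_r P M q x r - D_x P x)"

definition LSS ::
    "'x set \<Rightarrow> 'r set \<Rightarrow> 'x list pmf \<Rightarrow> ('x, 'q, 'r) mechanism \<Rightarrow> 'q \<Rightarrow> real \<Rightarrow> real \<Rightarrow> bool" where
  "LSS X R P M q \<epsilon> \<delta> \<longleftrightarrow>
     (\<forall>B\<subseteq>R. (\<Sum>\<^sub>\<infinity>r\<in>B. D_r P M q r * (stability_loss X P M q r - \<epsilon>)) \<le> \<delta>)"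

definition LMI ::
    "'x set \<Rightarrow> 'r set \<Rightarrow> 'x list pmf \<Rightarrow> ('x, 'q, 'r) mechanism \<Rightarrow> 'q \<Rightarrow> real \<Rightarrow> real \<Rightarrow> bool" where
  "LMI X R P M q \<epsilon> \<delta> \<longleftrightarrow>
     (\<forall>b\<subseteq>X \<times> R.
        D_joint P M q b \<le> exp \<epsilon> * D_product P M q b + \<delta> \<and>
        D_product P M q b \<le> exp \<epsilon> * D_joint P M q b + \<delta>)"

text \<open>The index, not the value, is uniform: repeated elements are output with their multiplicity.\<close>

definition uniform_sampling :: "('x, 'q, 'x) mechanism" where
  "uniform_sampling s q = map_pmf (\<lambda>i. s ! i) (pmf_of_set {..<length s})"

text \<open>Distributions in which every element has probability at most \<open>1 / n\<^sup>2\<close> exist on every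
  domain \<open>{1, \<dots>, N}\<close> with \<open>N > n\<^sup>2\<close>.\<close>

lemma ex_spread_distribution:
  fixes n N :: nat
  assumes "0 < n" "n\<^sup>2 < N"
  shows "\<exists>D :: nat pmf. set_pmf D \<subseteq> {1..N} \<and> (\<forall>x\<in>{1..N}. pmf D x \<le> 1 / (real n)\<^sup>2)"
proof (intro exI conjI ballI)
  have N: "{1..N} \<noteq> {}" "(real n)\<^sup>2 \<le> real N"
    using assms by (auto simp flip: of_nat_power)
  show "set_pmf (pmf_of_set {1..N}) \<subseteq> {1..N}"
    using N by simp
  show "pmf (pmf_of_set {1..N}) x \<le> 1 / (real n)\<^sup>2" if "x \<in> {1..N}" for x
    using N assms that by (simp add: frac_le)
qed

end

theory Submission imports Defs begin

text \<open>
  Write \<open>p\<close> for \<open>D\<close> on \<open>X\<close>.  The response has the same conditional law given \<open>s\<close> as a uniformly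
  chosen sample element, so all induced distributions are first and second moments of occurrence
  counts: \<open>D(x) = D(r) = p\<close>, and the joint mass of \<open>(x, r)\<close> is \<open>(1 - 1/n) p(x) p(r)\<close>, plus
  \<open>p(x) / n\<close> if \<open>x = r\<close>.  Hence only \<open>x = r\<close> contributes to the stability loss, which is at most
  \<open>1 / n\<close>, uniformly in \<open>r\<close>, so no concentration argument is needed for LSS.  The diagonal violates
  LMI: its joint mass is at least \<open>1 / n\<close>, its product mass at most \<open>1 / n\<^sup>2\<close>, and \<open>n > 2 e\<close>.
\<close>

section \<open>Relative frequencies and the law of the response\<close>

lemma D_x_given_s_eq_count: "D_x_given_s x s = real (count_list s x) / real (length s)"
  by (simp add: D_x_given_s_def count_list_eq_length_filter length_filter_conv_card eq_commute)

text \<open>A response equals \<open>r\<close> exactly when the drawn index lies in the preimage of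
  \<open>r\<close>, so repeated elements get their multiplicity. The empty list is excluded because
  \<open>pmf_of_set {}\<close> is unspecified.\<close>

lemma pmf_uniform_sampling:
  assumes "s \<noteq> []"
  shows "pmf (uniform_sampling s q) r = D_x_given_s r s"
proof -
  have "pmf (uniform_sampling s q) r = real (card ({..<length s} \<inter> (!) s -` {r})) / real (length s)"
    using assms by (simp add: uniform_sampling_def pmf_map measure_pmf_of_set lessThan_empty_iff)
  also have "{..<length s} \<inter> (!) s -` {r} = {i. i < length s \<and> s ! i = r}"
    by auto
  finally show ?thesis
    by (simp add: D_x_given_s_def)
qed

section \<open>First and second moments of occurrence counts\<close>

lemma nn_integral_indicator_eq_pmf:
  "(\<integral>\<^sup>+a. ennreal (of_bool (a = x)) \<partial>measure_pmf D) = ennreal (pmf D x)"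
proof -
  have "(\<integral>\<^sup>+a. ennreal (of_bool (a = x)) \<partial>measure_pmf D) = (\<integral>\<^sup>+a. indicator {x} a \<partial>measure_pmf D)"
    by (intro nn_integral_cong) (simp add: indicator_def)
  then show ?thesis
    by (simp add: emeasure_pmf_single)
qed

text \<open>Drawing the tail before the head puts the head's integral innermost, where counts in the
  tail are constants. This is the induction step for both moments.\<close>

lemma nn_integral_replicate_pmf_Suc:
  fixes f :: "'a list \<Rightarrow> ennreal"
  shows "(\<integral>\<^sup>+s. f s \<partial>measure_pmf (replicate_pmf (Suc n) D))
    = (\<integral>\<^sup>+s. (\<integral>\<^sup>+a. f (a # s) \<partial>measure_pmf D) \<partial>measure_pmf (replicate_pmf n D))"
proof -
  have "replicate_pmf (Suc n) D
      = replicate_pmf n D \<bind> (\<lambda>s. D \<bind> (\<lambda>a. return_pmf (a # s)))"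
    unfolding replicate_pmf.simps by (rule bind_commute_pmf)
  then show ?thesis
    by (simp only: nn_integral_bind_pmf nn_integral_return_pmf zero_le)
qed

lemma nn_integral_count_list:
  "(\<integral>\<^sup>+s. ennreal (count_list s x) \<partial>measure_pmf (replicate_pmf n D)) = ennreal (n * pmf D x)"
proof (induction n)
  case (Suc n)
  have eq: "ennreal (count_list (a # s) x) = ennreal (count_list s x) + ennreal (of_bool (a = x))"
    for a s by (simp flip: ennreal_plus)
  have "(\<integral>\<^sup>+s. ennreal (count_list s x) \<partial>measure_pmf (replicate_pmf (Suc n) D))
    = ennreal (n * pmf D x) + ennreal (pmf D x)"
    by (simp only: nn_integral_replicate_pmf_Suc eq)
      (simp add: nn_integral_add nn_integral_indicator_eq_pmf Suc.IH)
  also have "\<dots> = ennreal (Suc n * pmf D x)"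
    by (subst ennreal_plus[symmetric]) (auto simp: algebra_simps)
  finally show ?case .
qed simp

lemma nn_integral_count_list_mult:
  "(\<integral>\<^sup>+s. ennreal (count_list s x * count_list s y) \<partial>measure_pmf (replicate_pmf n D))
    = ennreal (of_bool (x = y) * (n * pmf D x) + n * (real n - 1) * (pmf D x * pmf D y))"
proof (induction n)
  case (Suc n)
  let ?b = "\<lambda>x a. ennreal (of_bool (a = x))"
  \<comment> \<open>Expansion of the product of the two incremented counts; the head equals both
    \<open>x\<close> and \<open>y\<close> only if \<open>x = y\<close>, which gives the last
    term.\<close>
  have eq: "ennreal (count_list (a # s) x * count_list (a # s) y)
      = ennreal (count_list s x * count_list s y) + (ennreal (count_list s y) * ?b x a
        + (ennreal (count_list s x) * ?b y a + ennreal (of_bool (x = y)) * ?b x a))"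
    for a s
    by (auto simp: algebra_simps simp flip: ennreal_plus ennreal_mult'')
  \<comment> \<open>\<open>ennreal\<close> truncates negative reals, so merging the summands needs
    this sign. For \<open>n = 0\<close> the factor \<open>real n - 1\<close> is negative, but the
    product is \<open>0\<close>.\<close>
  have nonneg: "0 \<le> n * (real n - 1) * (pmf D x * pmf D y)"
    by (cases n) auto
  have "(\<integral>\<^sup>+s. ennreal (count_list s x * count_list s y) \<partial>measure_pmf (replicate_pmf (Suc n) D))
    = ennreal (of_bool (x = y) * (n * pmf D x) + n * (real n - 1) * (pmf D x * pmf D y))
      + (ennreal (n * pmf D y) * ennreal (pmf D x) + (ennreal (n * pmf D x) * ennreal (pmf D y)
      + ennreal (of_bool (x = y)) * ennreal (pmf D x)))"
    by (simp only: nn_integral_replicate_pmf_Suc eq)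
      (simp add: nn_integral_add nn_integral_cmult nn_integral_multc nn_integral_indicator_eq_pmf
        nn_integral_count_list Suc.IH del: of_nat_mult)
  also have "\<dots> = ennreal ((of_bool (x = y) * (n * pmf D x) + n * (real n - 1) * (pmf D x * pmf D y))
      + (n * pmf D y * pmf D x + (n * pmf D x * pmf D y + of_bool (x = y) * pmf D x)))"
    using nonneg by (simp flip: ennreal_plus ennreal_mult'')
  also have "\<dots> = ennreal (of_bool (x = y) * (Suc n * pmf D x)
      + Suc n * (real (Suc n) - 1) * (pmf D x * pmf D y))"
    by (simp add: algebra_simps)
  finally show ?case .
qed simp

section \<open>The induced distributions of an independent sample\<close>

lemma infsum_pmf_mult_eq:
  assumes "\<And>s. 0 \<le> f s" "0 \<le> c"
    and "(\<integral>\<^sup>+s. ennreal (f s) \<partial>measure_pmf P) = ennreal c"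
  shows "(\<Sum>\<^sub>\<infinity>s. pmf P s * f s) = c"
proof -
  \<comment> \<open>A finite nonnegative integral makes the series absolutely convergent, so
    \<open>infsum\<close> is its true value and not the default \<open>0\<close>.\<close>
  have int: "integrable (measure_pmf P) f"
    by (rule integrableI_nonneg) (use assms in auto)
  have "integrable (count_space UNIV) (\<lambda>s. pmf P s * f s)"
    using int by (simp add: measure_pmf_eq_density integrable_density)
  then have "(\<Sum>\<^sub>\<infinity>s. pmf P s * f s) = measure_pmf.expectation P f"
    by (simp add: pmf_expectation_eq_infsetsum infsetsum_infsum abs_summable_on_def)
  moreover have "measure_pmf.expectation P f = c"
    using assms by (simp add: integral_eq_nn_integral)
  ultimately show ?thesis by simp
qed

lemma D_x_replicate_pmf:
  assumes "0 < n"
  shows "D_x (replicate_pmf n D) x = pmf D x"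
proof -
  have "D_x (replicate_pmf n D) x = (\<Sum>\<^sub>\<infinity>s. pmf (replicate_pmf n D) s * count_list s x / n)"
    unfolding D_x_def D_x_given_s_eq_count
    by (intro infsum_cong) (auto simp: pmf_eq_0_set_pmf set_replicate_pmf)
  also have "\<dots> = pmf D x"
    using assms infsum_pmf_mult_eq[OF _ _ nn_integral_count_list, of x n D]
    by (simp add: divide_inverse infsum_cmult_left')
  finally show ?thesis .
qed

text \<open>Both conditional laws are frequencies, so this is the second moment of the counts
  divided by \<open>n\<^sup>2\<close>. Lists outside the support have weight \<open>0\<close>, so
  every length may be taken to be \<open>n\<close>.\<close>

lemma infsum_D_x_given_s_mult:
  assumes "0 < n"
  shows "(\<Sum>\<^sub>\<infinity>s. pmf (replicate_pmf n D) s * D_x_given_s x s * pmf (uniform_sampling s q) r)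
    = of_bool (x = r) * (pmf D x / n) + (1 - 1 / n) * (pmf D x * pmf D r)"
proof -
  have "0 \<le> real n * (real n - 1)" using assms by simp
  then have nonneg: "0 \<le> of_bool (x = r) * (n * pmf D x) + n * (real n - 1) * (pmf D x * pmf D r)"
    by simp
  have "(\<Sum>\<^sub>\<infinity>s. pmf (replicate_pmf n D) s * D_x_given_s x s * pmf (uniform_sampling s q) r)
    = (\<Sum>\<^sub>\<infinity>s. pmf (replicate_pmf n D) s * (count_list s x * count_list s r) / n\<^sup>2)"
  proof (rule infsum_cong)
    fix s
    show "pmf (replicate_pmf n D) s * D_x_given_s x s * pmf (uniform_sampling s q) r
      = pmf (replicate_pmf n D) s * (count_list s x * count_list s r) / n\<^sup>2"
    proof (cases "s \<in> set_pmf (replicate_pmf n D)")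
      case True
      then have "length s = n" "s \<noteq> []" using assms by (auto simp: set_replicate_pmf)
      then show ?thesis
        by (simp add: pmf_uniform_sampling D_x_given_s_eq_count power2_eq_square)
    qed (simp add: set_pmf_iff)
  qed
  also have "\<dots> = (of_bool (x = r) * (n * pmf D x) + n * (real n - 1) * (pmf D x * pmf D r)) / n\<^sup>2"
    using infsum_pmf_mult_eq[OF _ nonneg nn_integral_count_list_mult]
    by (simp add: divide_inverse infsum_cmult_left')
  also have "\<dots> = of_bool (x = r) * (pmf D x / n) + (1 - 1 / n) * (pmf D x * pmf D r)"
    using assms by (simp add: field_simps power2_eq_square)
  finally show ?thesis .
qed

lemma D_r_uniform_sampling:
  assumes "0 < n"
  shows "D_r (replicate_pmf n D) uniform_sampling q r = pmf D r"
proof -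
  have "D_r (replicate_pmf n D) uniform_sampling q r = D_x (replicate_pmf n D) r"
    unfolding D_r_def D_x_def
  proof (rule infsum_cong)
    fix s
    show "pmf (replicate_pmf n D) s * pmf (uniform_sampling s q) r
      = pmf (replicate_pmf n D) s * D_x_given_s r s"
      using assms
      by (cases "s \<in> set_pmf (replicate_pmf n D)")
        (auto simp: pmf_eq_0_set_pmf set_replicate_pmf pmf_uniform_sampling)
  qed
  then show ?thesis by (simp add: D_x_replicate_pmf assms)
qed

lemma D_x_given_r_uniform_sampling:
  assumes "0 < n" "pmf D r \<noteq> 0"
  shows "D_x_given_r (replicate_pmf n D) uniform_sampling q x r
    = of_bool (x = r) / n + (1 - 1 / n) * pmf D x"
proof -
  have "D_x_given_r (replicate_pmf n D) uniform_sampling q x r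
    = (\<Sum>\<^sub>\<infinity>s. pmf (replicate_pmf n D) s * D_x_given_s x s * pmf (uniform_sampling s q) r / pmf D r)"
    unfolding D_x_given_r_def D_s_given_r_def D_r_uniform_sampling[OF assms(1)]
    by (intro infsum_cong) simp
  also have "\<dots> = (of_bool (x = r) * (pmf D x / n) + (1 - 1 / n) * (pmf D x * pmf D r)) / pmf D r"
    using infsum_D_x_given_s_mult[OF assms(1), of D x q r]
    by (simp add: divide_inverse infsum_cmult_left')
  also have "\<dots> = of_bool (x = r) / n + (1 - 1 / n) * pmf D x"
    using assms by (auto simp: field_simps)
  finally show ?thesis .
qed

section \<open>Local statistical stability\<close>

lemma stability_loss_uniform_sampling_le:
  assumes "0 < n" "pmf D r \<noteq> 0"
  shows "stability_loss X (replicate_pmf n D) uniform_sampling q r \<le> 1 / n"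
proof -
  let ?S = "{x \<in> X. D_x_given_r (replicate_pmf n D) uniform_sampling q x r
    > D_x (replicate_pmf n D) x}"
  \<comment> \<open>For \<open>x \<noteq> r\<close> conditioning on \<open>r\<close> only shrinks
    the mass of \<open>x\<close>, by the factor \<open>1 - 1 / n\<close>.\<close>
  have "\<not> pmf D x < (1 - 1 / n) * pmf D x" for x
    unfolding not_less by (intro mult_left_le_one_le) (use assms in auto)
  then have "x = r" if "x \<in> ?S" for x
    using assms that
    by (cases "x = r") (simp_all add: D_x_given_r_uniform_sampling D_x_replicate_pmf)
  then have "?S \<subseteq> {r}" by blast
  \<comment> \<open>Whether \<open>r\<close> belongs to \<open>?S\<close> depends on
    \<open>r \<in> X\<close> and \<open>pmf D r < 1\<close>; if it does, its surplus is
    \<open>(1 - pmf D r) / n\<close>.\<close>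
  then consider "?S = {}" | "?S = {r}" by blast
  then show ?thesis
  proof cases
    case 1
    show ?thesis unfolding stability_loss_def 1 by simp
  next
    case 2
    show ?thesis unfolding stability_loss_def 2
      using assms by (simp add: D_x_given_r_uniform_sampling D_x_replicate_pmf algebra_simps)
  qed
qed

lemma LSS_uniform_sampling:
  assumes "0 < n" "1 / n \<le> \<epsilon>" "0 \<le> \<delta>"
  shows "LSS X R (replicate_pmf n D) uniform_sampling q \<epsilon> \<delta>"
  unfolding LSS_def
proof (intro allI impI)
  fix B
  let ?f = "\<lambda>r. D_r (replicate_pmf n D) uniform_sampling q r
    * (stability_loss X (replicate_pmf n D) uniform_sampling q r - \<epsilon>)"
  \<comment> \<open>Every term of the sum is nonpositive. The rules for signs of infinite sums used
    below hold with or without convergence.\<close>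
  have "0 \<le> - ?f r" for r
  proof (cases "pmf D r = 0")
    case False
    then show ?thesis
      using stability_loss_uniform_sampling_le[OF assms(1) False, of X q] assms
      by (simp add: D_r_uniform_sampling mult_nonneg_nonpos)
  qed (simp add: D_r_uniform_sampling assms)
  then have "0 \<le> (\<Sum>\<^sub>\<infinity>r\<in>B. - ?f r)"
    by (rule infsum_nonneg)
  then have "0 \<le> - (\<Sum>\<^sub>\<infinity>r\<in>B. ?f r)"
    by (simp only: infsum_uminus)
  then show "(\<Sum>\<^sub>\<infinity>r\<in>B. ?f r) \<le> \<delta>"
    using assms by linarith
qed

section \<open>Failure of local max information on the diagonal\<close>

lemma pmf_has_sum:
  assumes "set_pmf D \<subseteq> X"
  shows "(pmf D has_sum 1) X"
proof -
  have "(pmf D has_sum infsum (pmf D) X) X"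
    by (rule has_sum_infsum[OF abs_summable_summable])
      (simp only: abs_summable_equivalent pmf_abs_summable)
  moreover have "infsum (pmf D) X = measure (measure_pmf D) X"
    by (simp add: measure_pmf_conv_infsetsum infsetsum_infsum pmf_abs_summable)
  moreover have "measure (measure_pmf D) X = 1"
    using assms by (subst measure_pmf.prob_eq_1) (auto simp: AE_measure_pmf_iff)
  ultimately show ?thesis by simp
qed

lemma infsum_diagonal: "(\<Sum>\<^sub>\<infinity>(x, r)\<in>(\<lambda>x. (x, x)) ` X. f x r) = (\<Sum>\<^sub>\<infinity>x\<in>X. f x x)"
  by (subst infsum_reindex) (auto simp: inj_on_def o_def)

text \<open>On the diagonal the product mass is the sum of the squares of \<open>pmf D x\<close>, at
  most \<open>c\<close> times the total mass, while the terms \<open>pmf D x / n\<close> alone give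
  joint mass \<open>1 / n\<close>. This refutes the bound of the joint by the product.\<close>

lemma not_LMI_uniform_sampling:
  assumes "0 < n" "set_pmf D \<subseteq> X" "\<forall>x\<in>X. pmf D x \<le> c"
    and "exp \<epsilon> * c + \<delta> < 1 / n"
  shows "\<not> LMI X X (replicate_pmf n D) uniform_sampling q \<epsilon> \<delta>"
proof
  assume LMI: "LMI X X (replicate_pmf n D) uniform_sampling q \<epsilon> \<delta>"
  let ?b = "(\<lambda>x. (x, x)) ` X"
  have sum1: "(pmf D has_sum 1) X" by (rule pmf_has_sum[OF assms(2)])
  have sumc: "((\<lambda>x. c * pmf D x) has_sum c) X"
    using has_sum_cmult_right[OF sum1, of c] by simp
  have le: "pmf D x * pmf D x \<le> c * pmf D x" if "x \<in> X" for x
    using assms(3) that by (simp add: mult_right_mono)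
  have sq: "(\<lambda>x. pmf D x * pmf D x) summable_on X"
    by (rule summable_on_comparison_test[OF has_sum_imp_summable[OF sumc] le]) simp_all
  have "D_product (replicate_pmf n D) uniform_sampling q ?b = (\<Sum>\<^sub>\<infinity>x\<in>X. pmf D x * pmf D x)"
    using assms(1)
    by (simp add: D_product_def infsum_diagonal D_x_replicate_pmf D_r_uniform_sampling)
  also have "\<dots> \<le> c"
    by (rule has_sum_mono[OF has_sum_infsum[OF sq] sumc le])
  finally have prod: "D_product (replicate_pmf n D) uniform_sampling q ?b \<le> c" .
  have sumn: "((\<lambda>x. pmf D x / n) has_sum 1 / n) X"
    using has_sum_divide_const[OF sum1] .
  have "1 / n \<le> (\<Sum>\<^sub>\<infinity>x\<in>X. pmf D x / n + (1 - 1 / n) * (pmf D x * pmf D x))"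
  proof (rule has_sum_mono[OF sumn has_sum_infsum])
    show "(\<lambda>x. pmf D x / n + (1 - 1 / n) * (pmf D x * pmf D x)) summable_on X"
      by (intro summable_on_add summable_on_cmult_right sq has_sum_imp_summable[OF sumn])
    show "pmf D x / n \<le> pmf D x / n + (1 - 1 / n) * (pmf D x * pmf D x)" for x
      using assms(1) by simp
  qed
  also have "\<dots> = D_joint (replicate_pmf n D) uniform_sampling q ?b"
    unfolding D_joint_def infsum_diagonal infsum_D_x_given_s_mult[OF assms(1)] by simp
  also have "\<dots> \<le> exp \<epsilon> * D_product (replicate_pmf n D) uniform_sampling q ?b + \<delta>"
    using LMI[unfolded LMI_def, rule_format, of ?b] by blast
  also have "\<dots> \<le> exp \<epsilon> * c + \<delta>"
    using prod by simp
  finally show False using assms(4) by simp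
qed

text \<open>\<open>replicate_pmf n D\<close> is the product distribution. At
  \<open>\<delta> = 0\<close> the threshold for \<open>n\<close> is infinite in the usual reading,
  whereas \<open>2 / 0\<close> is \<open>0\<close> here; hence \<open>0 < \<delta>\<close>.\<close>

theorem theorem4p15:
  fixes X :: "'x set" and D :: "'x pmf" and q :: 'q and n :: nat and \<delta> :: real
  assumes "countable X" and "set_pmf D \<subseteq> X"
    and "\<forall>x\<in>X. pmf D x \<le> 1 / (real n)\<^sup>2"
    and "0 < \<delta>" and "\<delta> \<le> 1"
    and "real n > max (2 * ln (2 / \<delta>)) 6"
  shows "LSS X X (replicate_pmf n D) uniform_sampling q
           (11 * sqrt (ln (2 * real n / \<delta>) / real n)) \<delta>
       \<and> \<not> LMI X X (replicate_pmf n D) uniform_sampling q 1 (1 / (2 * real n))"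
proof
  have n: "0 < n" "6 < real n" using assms(6) by auto
  have e: "exp 1 \<le> (3 :: real)" by (rule exp_le)
  \<comment> \<open>The constant \<open>3\<close> bounds \<open>exp 1\<close>, so the logarithm will
    be at least \<open>1\<close>, hence at least \<open>1 / n\<close>.\<close>
  have "3 * \<delta> \<le> 2 * real n"
    using assms(5) n by linarith
  then have "3 \<le> 2 * real n / \<delta>"
    using assms(4) by (simp add: pos_le_divide_eq)
  then have "1 \<le> ln (2 * real n / \<delta>)"
    using e by (subst ln_ge_iff) linarith+
  moreover have "1 / real n \<le> 1" using n(1) by simp
  ultimately have "1 / real n \<le> ln (2 * real n / \<delta>)" by linarith
  then have "1 / real n / real n \<le> ln (2 * real n / \<delta>) / real n"
    by (rule divide_right_mono) simp
  then have "(1 / real n)\<^sup>2 \<le> ln (2 * real n / \<delta>) / real n"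
    by (simp add: power2_eq_square)
  then have "1 / real n \<le> sqrt (ln (2 * real n / \<delta>) / real n)"
    by (rule real_le_rsqrt)
  \<comment> \<open>Positivity of the square root follows, which allows enlarging it by the factor
    \<open>11\<close>.\<close>
  moreover have "0 < 1 / real n" using n(1) by simp
  ultimately have "1 / real n \<le> 11 * sqrt (ln (2 * real n / \<delta>) / real n)"
    by linarith
  then show "LSS X X (replicate_pmf n D) uniform_sampling q
      (11 * sqrt (ln (2 * real n / \<delta>) / real n)) \<delta>"
    using n(1) assms(4) by (intro LSS_uniform_sampling) linarith+
  \<comment> \<open>Half of the joint mass \<open>1 / n\<close> is taken by the additive
    \<open>1 / (2 * n)\<close>; the other half exceeds \<open>3 / n\<^sup>2\<close> precisely when
    \<open>n > 6\<close>.\<close>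
  have "exp 1 * (1 / (real n)\<^sup>2) \<le> 3 * (1 / (real n)\<^sup>2)"
    by (rule mult_right_mono[OF e]) simp
  also have "\<dots> = 3 / real n * (1 / real n)"
    by (simp add: power2_eq_square)
  also have "\<dots> < 1 / 2 * (1 / real n)"
    using n by (intro mult_strict_right_mono) (simp_all add: pos_divide_less_eq)
  finally have "exp 1 * (1 / (real n)\<^sup>2) + 1 / (2 * real n) < 1 / real n"
    by simp
  then show "\<not> LMI X X (replicate_pmf n D) uniform_sampling q 1 (1 / (2 * real n))"
    by (rule not_LMI_uniform_sampling[OF n(1) assms(2,3)])
qed

end
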